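(* Let $n\geq 3$ be an integer, let $P_n$ be the path on $n$ vertices and $P$ the Petersen graph. Then $$\mathrm{rn}(P_n \,\square\, P) = \begin{cases} 5n^2-n+1, & n \text{ even},\\ 5n^2-n+6, & n \text{ odd}.\end{cases}$$
   Context: The Petersen graph $P$ is the complement of the line graph of $K_5$ (10 vertices, 3-regular, diameter 2). The Cartesian product $G\,\square\, H$ has vertex set $V(G)\times V(H)$, with $(a,b)$ adjacent to $(c,e)$ iff either $a=c$ and $be\in E(H)$, or $b=e$ and $ac\in E(G)$. A radio labeling of a connected graph $G$ is a map $\varphi: V(G)\to\{0,1,2,\dots\}$ such that $d(u,v)+|\varphi(u)-\varphi(v)| \geq \mathrm{diam}(G)+1$ for every pair of distinct vertices $u,v$, where $d$ is graph distance and $\mathrm{diam}(G)$ the diameter. The span of $\varphi$ is $\max\{|\varphi(u)-\varphi(v)| : u,v\in V(G)\}$, and the radio number $\mathrm{rn}(G)$ is the minimum span over all radio labelings of $G$. *)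

theory Defs
  imports "Graph_Theory.Graph_Theory"
begin

text \<open>
  An undirected simple graph is a loop-free symmetric \<^typ>\<open>'a pair_pre_digraph\<close>
  (locale \<^locale>\<open>pair_graph\<close>): every edge is represented by its two opposite arcs.
\<close>

definition path_graph :: "nat \<Rightarrow> nat pair_pre_digraph" where
  "path_graph n =
     \<lparr> pverts = {..<n}, parcs = {(i, j). i < n \<and> j < n \<and> (j = Suc i \<or> i = Suc j)} \<rparr>"

definition complete_graph :: "nat \<Rightarrow> nat pair_pre_digraph" where
  "complete_graph n = \<lparr> pverts = {..<n}, parcs = {(i, j). i < n \<and> j < n \<and> i \<noteq> j} \<rparr>"

text \<open>The two opposite arcs of an edge give the same vertex \<open>{u, v}\<close> of the line graph.\<close>

definition line_graph :: "'a pair_pre_digraph \<Rightarrow> 'a set pair_pre_digraph" where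
  "line_graph G =
     (let E = {{u, v} | u v. (u, v) \<in> parcs G}
      in \<lparr> pverts = E, parcs = {(e, f). e \<in> E \<and> f \<in> E \<and> e \<noteq> f \<and> e \<inter> f \<noteq> {}} \<rparr>)"

definition graph_complement :: "'a pair_pre_digraph \<Rightarrow> 'a pair_pre_digraph" where
  "graph_complement G =
     \<lparr> pverts = pverts G,
       parcs = {(u, v). u \<in> pverts G \<and> v \<in> pverts G \<and> u \<noteq> v \<and> (u, v) \<notin> parcs G} \<rparr>"

definition petersen_graph :: "nat set pair_pre_digraph" where
  "petersen_graph = graph_complement (line_graph (complete_graph 5))"

definition cartesian_product ::
  "'a pair_pre_digraph \<Rightarrow> 'b pair_pre_digraph \<Rightarrow> ('a \<times> 'b) pair_pre_digraph"
  (infixr \<open>\<box>\<close> 70) where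
  "G \<box> H =
     \<lparr> pverts = pverts G \<times> pverts H,
       parcs = {((a, b), (c, e)). a \<in> pverts G \<and> c \<in> pverts G \<and> b \<in> pverts H \<and> e \<in> pverts H \<and>
                  (a = c \<and> (b, e) \<in> parcs H \<or> b = e \<and> (a, c) \<in> parcs G)} \<rparr>"

text \<open>
  The notions below are meant for finite nonempty connected graphs; otherwise
  \<open>LEAST\<close> and \<open>Max\<close> may range over the empty set or an infinite set.
\<close>

definition graph_dist :: "'a pair_pre_digraph \<Rightarrow> 'a \<Rightarrow> 'a \<Rightarrow> nat" where
  "graph_dist G u v = (LEAST k. \<exists>p. pre_digraph.awalk (with_proj G) u p v \<and> length p = k)"

definition graph_diam :: "'a pair_pre_digraph \<Rightarrow> nat" where
  "graph_diam G = Max {graph_dist G u v | u v. u \<in> pverts G \<and> v \<in> pverts G}"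

definition radio_labeling :: "'a pair_pre_digraph \<Rightarrow> ('a \<Rightarrow> nat) \<Rightarrow> bool" where
  "radio_labeling G \<phi> \<longleftrightarrow>
     (\<forall>u\<in>pverts G. \<forall>v\<in>pverts G. u \<noteq> v \<longrightarrow>
        int (graph_dist G u v) + \<bar>int (\<phi> u) - int (\<phi> v)\<bar> \<ge> int (graph_diam G) + 1)"

definition labeling_span :: "'a pair_pre_digraph \<Rightarrow> ('a \<Rightarrow> nat) \<Rightarrow> nat" where
  "labeling_span G \<phi> =
     Max {nat \<bar>int (\<phi> u) - int (\<phi> v)\<bar> | u v. u \<in> pverts G \<and> v \<in> pverts G}"

definition radio_number :: "'a pair_pre_digraph \<Rightarrow> nat" where
  "radio_number G = (LEAST k. \<exists>\<phi>. radio_labeling G \<phi> \<and> labeling_span G \<phi> = k)"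


text \<open>Agreement with the library's shortest-path cost and complete graphs.\<close>

lemma graph_dist_eq_mu:
  assumes "wf_digraph (with_proj G)" "u \<rightarrow>\<^sup>*\<^bsub>with_proj G\<^esub> v"
  shows "wf_digraph.\<mu> (with_proj G) (\<lambda>_. 1) u v = ereal (real (graph_dist G u v))"
proof -
  interpret wf_digraph "with_proj G" by fact
  let ?P = "\<lambda>k. \<exists>p. awalk u p v \<and> length p = k"
  have cost: "awalk_cost (\<lambda>_. 1) p = real (length p)" for p
    by (simp add: awalk_cost_def sum_list_triv)
  have "\<exists>k. ?P k" using assms(2) reachable_awalk by auto
  then have "?P (graph_dist G u v)" unfolding graph_dist_def by (rule LeastI_ex)
  then obtain p where p: "awalk u p v" "length p = graph_dist G u v" by blast
  show ?thesis unfolding \<mu>_def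
  proof (rule antisym)
    show "(INF p\<in>{p. awalk u p v}. ereal (awalk_cost (\<lambda>_. 1) p))
        \<le> ereal (real (graph_dist G u v))"
      using p by (intro INF_lower2[of p]) (auto simp: cost)
    show "ereal (real (graph_dist G u v))
        \<le> (INF p\<in>{p. awalk u p v}. ereal (awalk_cost (\<lambda>_. 1) p))"
      by (rule INF_greatest) (auto simp: cost graph_dist_def intro: Least_le)
  qed
qed

lemma pair_graphI:
  assumes "finite (pverts G)"
    and "\<And>u v. (u, v) \<in> parcs G \<Longrightarrow> u \<in> pverts G \<and> v \<in> pverts G \<and> u \<noteq> v \<and> (v, u) \<in> parcs G"
  shows "pair_graph G"
proof -
  have "parcs G \<subseteq> pverts G \<times> pverts G" using assms(2) by auto
  then have "finite (parcs G)" using assms(1) finite_subset by blast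
  with assms show ?thesis
    by unfold_locales (fastforce simp: symmetric_def sym_def)+
qed

lemma pair_graphD:
  assumes "pair_graph G"
  shows "finite (pverts G)"
    and "(u, v) \<in> parcs G \<Longrightarrow> u \<in> pverts G \<and> v \<in> pverts G \<and> u \<noteq> v \<and> (v, u) \<in> parcs G"
proof -
  interpret pair_graph G by fact
  show "finite (pverts G)" by (rule pair_finite_verts)
  show "(u, v) \<in> parcs G \<Longrightarrow> u \<in> pverts G \<and> v \<in> pverts G \<and> u \<noteq> v \<and> (v, u) \<in> parcs G"
    using in_arcsD1 in_arcsD2 pair_no_loops pair_sym_arcs
    by (fastforce simp: symmetric_def sym_def)
qed

lemma complete_digraph_complete_graph: "K\<^bsub>n\<^esub> (with_proj (complete_graph n))"
proof -
  have "pair_graph (complete_graph n)" by (rule pair_graphI) (auto simp: complete_graph_def)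
  then interpret pair_graph "complete_graph n" .
  show ?thesis unfolding complete_digraph_def
    by (auto simp: complete_graph_def graph_axioms[unfolded complete_graph_def])
qed

lemma pair_graph_path: "pair_graph (path_graph n)"
  by (rule pair_graphI) (auto simp: path_graph_def)

lemma pair_graph_complement:
  assumes "pair_graph G"
  shows "pair_graph (graph_complement G)"
  by (rule pair_graphI) (use pair_graphD[OF assms] in \<open>auto simp: graph_complement_def\<close>)

lemma pair_graph_line:
  assumes "pair_graph G"
  shows "pair_graph (line_graph G)"
proof (rule pair_graphI)
  have "pverts (line_graph G) \<subseteq> Pow (pverts G)"
    using pair_graphD(2)[OF assms] by (auto simp: line_graph_def)
  then show "finite (pverts (line_graph G))"
    using pair_graphD(1)[OF assms] finite_subset by blast
qed (auto simp: line_graph_def Let_def)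

lemma pair_graph_petersen: "pair_graph petersen_graph"
  unfolding petersen_graph_def
  by (intro pair_graph_complement pair_graph_line pair_graphI) (auto simp: complete_graph_def)

lemma pair_graph_product:
  assumes "pair_graph G" "pair_graph H"
  shows "pair_graph (G \<box> H)"
  by (rule pair_graphI)
    (use pair_graphD[OF assms(1)] pair_graphD[OF assms(2)] in
      \<open>auto simp: cartesian_product_def\<close>)

text \<open>Explicit description of the Petersen graph: the Kneser graph on 2-subsets of \<open>{0..4}\<close>.\<close>

lemma pverts_petersen:
  "pverts petersen_graph = {{0,1},{0,2},{0,3},{0,4},{1,2},{1,3},{1,4},{2,3},{2,4},{3,4}}"
proof -
  have V: "{..<5} = {0, 1, 2, 3, 4 :: nat}" by auto
  have "pverts petersen_graph = (\<Union>u\<in>{..<5}. (\<lambda>v. {u, v}) ` ({..<5} - {u}))"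
    unfolding petersen_graph_def graph_complement_def line_graph_def complete_graph_def Let_def
    by auto
  then show ?thesis unfolding V by (simp add: insert_Diff_if insert_commute)
qed

lemma parcs_petersen:
  "parcs petersen_graph =
     {(e, f). e \<in> pverts petersen_graph \<and> f \<in> pverts petersen_graph \<and> e \<inter> f = {}}"
  by (auto simp: petersen_graph_def graph_complement_def line_graph_def Let_def)

lemma card_petersen: "card (pverts petersen_graph) = 10"
  unfolding pverts_petersen by (simp add: doubleton_eq_iff)

lemma petersen_diam2:
  assumes "e \<in> pverts petersen_graph" "f \<in> pverts petersen_graph"
  shows "e = f \<or> (e, f) \<in> parcs petersen_graph \<or>
    (\<exists>g. (e, g) \<in> parcs petersen_graph \<and> (g, f) \<in> parcs petersen_graph)"
proof -
  have "e = f \<or> e \<inter> f = {} \<or> (\<exists>g\<in>pverts petersen_graph. e \<inter> g = {} \<and> g \<inter> f = {})"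
    using assms unfolding pverts_petersen
    by (elim insertE emptyE) (simp_all add: doubleton_eq_iff)
  then show ?thesis using assms by (auto simp: parcs_petersen)
qed

lemma strongly_connected_path_petersen:
  assumes "n \<ge> 1"
  shows "strongly_connected (with_proj (path_graph n \<box> petersen_graph))"
proof -
  let ?G = "path_graph n \<box> petersen_graph"
  interpret pair_graph ?G
    by (intro pair_graph_product pair_graph_path pair_graph_petersen)
  have V: "pverts ?G = {..<n} \<times> pverts petersen_graph"
    by (simp add: cartesian_product_def path_graph_def)
  have adj: "u \<rightarrow>\<^sup>*\<^bsub>with_proj ?G\<^esub> v" if "(u, v) \<in> parcs ?G" for u v
    using that by (intro reachable_adjI) simp_all
  have P: "(i, e) \<rightarrow>\<^sup>*\<^bsub>with_proj ?G\<^esub> (i, f)"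
    if "i < n" "e \<in> pverts petersen_graph" "f \<in> pverts petersen_graph" for i e f
  proof -
    have st: "(i, x) \<rightarrow>\<^sup>*\<^bsub>with_proj ?G\<^esub> (i, y)" if "(x, y) \<in> parcs petersen_graph" for x y
      using that \<open>i < n\<close>
      by (intro adj) (auto simp: cartesian_product_def path_graph_def parcs_petersen)
    have "(i, e) \<rightarrow>\<^sup>*\<^bsub>with_proj ?G\<^esub> (i, e)"
      using that by (intro reachable_refl) (simp add: V)
    then show ?thesis using petersen_diam2[OF that(2,3)] st reachable_trans by blast
  qed
  have "(0, e) \<rightarrow>\<^sup>*\<^bsub>with_proj ?G\<^esub> (i, e) \<and> (i, e) \<rightarrow>\<^sup>*\<^bsub>with_proj ?G\<^esub> (0, e)"
    if "i < n" "e \<in> pverts petersen_graph" for i e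
    using that
  proof (induction i)
    case 0
    then show ?case using reachable_refl[of "(0, e)"] by (simp add: V)
  next
    case (Suc i)
    then have "((i, e), (Suc i, e)) \<in> parcs ?G" "((Suc i, e), (i, e)) \<in> parcs ?G"
      by (auto simp: cartesian_product_def path_graph_def)
    then show ?case using Suc adj reachable_trans by (meson Suc_lessD)
  qed
  then have "u \<rightarrow>\<^sup>*\<^bsub>with_proj ?G\<^esub> v" if "u \<in> pverts ?G" "v \<in> pverts ?G" for u v
    using that P reachable_trans unfolding V by (smt (verit) SigmaE lessThan_iff)
  moreover have "pverts ?G \<noteq> {}" using assms by (simp add: V pverts_petersen lessThan_empty_iff)
  ultimately show ?thesis by (auto simp: strongly_connected_def)
qed

end

theory Submission
  imports Defs "HOL-Library.Infinite_Set"
begin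

text \<open>
  Order the \<open>10 * n\<close> vertices by label. Consecutive labels differ by at least \<open>n\<close> minus the
  distance of the two layers, and that distance is at most the sum of the distances of both layers
  from the middle of the path; summing over the ordering gives \<open>5 * n^2 - n + 1\<close> for even \<open>n\<close>
  and \<open>5 * n^2 - n + 5\<close> for odd \<open>n\<close>. For odd \<open>n\<close> equality would force the ordering to start and
  end in the centre layer and each of the 20 vertices of the two outermost layers to be next to a
  vertex of the centre layer, but the 10 vertices of that layer have only 18 neighbouring positions.

  The bounds are attained by orderings that jump by about half the path in each step and run through
  pairwise nonadjacent vertices of the Petersen graph. For odd \<open>n\<close> they traverse all layers in
  rounds, and one visit of the centre layer is postponed to the very end.
\<close>

section \<open>Distances and radio labelings\<close>

text \<open>A potential \<open>D\<close> that vanishes at \<open>v\<close> and drops by at most one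
  along each arc bounds the length of every walk to \<open>v\<close> from below. Away from
  \<open>v\<close> some arc always lowers it by exactly one, and following such arcs gives a walk of
  length \<open>D u\<close>.\<close>

lemma graph_dist_eqI:
  fixes D :: "'a \<Rightarrow> nat"
  assumes wf: "pair_graph G" and u: "u \<in> pverts G" and v: "v \<in> pverts G" "D v = 0"
    and lip: "\<And>x y. (x, y) \<in> parcs G \<Longrightarrow> D x \<le> Suc (D y)"
    and desc: "\<And>x. x \<in> pverts G \<Longrightarrow> x \<noteq> v \<Longrightarrow> \<exists>y. (x, y) \<in> parcs G \<and> D x = Suc (D y)"
  shows "graph_dist G u v = D u"
proof -
  interpret pair_graph G by fact
  have lower: "D x \<le> length p" if "awalk x p v" for x p
    using that
  proof (induction p arbitrary: x)
    case Nil
    then show ?case using v by (simp add: awalk_Nil_iff)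
  next
    case (Cons a p)
    then have "(x, snd a) \<in> parcs G" "awalk (snd a) p v" by (auto simp: awalk_Cons_iff)
    then show ?case using Cons.IH lip[of x "snd a"] by fastforce
  qed
  have upper: "\<exists>p. awalk x p v \<and> length p = d" if "x \<in> pverts G" "D x = d" for x d
    using that
  proof (induction d arbitrary: x)
    case 0
    then have "x = v" using desc by fastforce
    then show ?case using v by (auto simp: awalk_Nil_iff)
  next
    case (Suc d)
    then have "x \<noteq> v" using v by auto
    then obtain y where y: "(x, y) \<in> parcs G" "D x = Suc (D y)" using desc Suc by blast
    then have "y \<in> pverts G" using pair_graphD(2)[OF wf] by blast
    then obtain p where "awalk y p v" "length p = d" using Suc y by auto
    then have "awalk x ((x, y) # p) v \<and> length ((x, y) # p) = Suc d"
      using y by (simp add: awalk_Cons_iff)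
    then show ?case by blast
  qed
  show ?thesis
    unfolding graph_dist_def
    by (rule Least_equality) (use upper[OF u] lower in auto)
qed

lemma finite_abs_diffs:
  fixes \<phi> :: "'a \<Rightarrow> nat"
  assumes "finite V"
  shows "finite {nat \<bar>int (\<phi> u) - int (\<phi> v)\<bar> | u v. u \<in> V \<and> v \<in> V}"
proof -
  have "{nat \<bar>int (\<phi> u) - int (\<phi> v)\<bar> | u v. u \<in> V \<and> v \<in> V}
      = (\<lambda>(u, v). nat \<bar>int (\<phi> u) - int (\<phi> v)\<bar>) ` (V \<times> V)" by auto
  then show ?thesis using assms by simp
qed

lemma le_labeling_span:
  assumes "finite (pverts G)" "u \<in> pverts G" "v \<in> pverts G"
  shows "\<bar>int (\<phi> u) - int (\<phi> v)\<bar> \<le> int (labeling_span G \<phi>)"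
proof -
  have "nat \<bar>int (\<phi> u) - int (\<phi> v)\<bar> \<le> labeling_span G \<phi>"
    unfolding labeling_span_def using assms finite_abs_diffs[of "pverts G" \<phi>]
    by (intro Max_ge) auto
  then show ?thesis by linarith
qed

lemma labeling_span_le:
  assumes "finite (pverts G)" "pverts G \<noteq> {}" "\<And>v. v \<in> pverts G \<Longrightarrow> \<phi> v \<le> N"
  shows "labeling_span G \<phi> \<le> N"
proof -
  let ?S = "{nat \<bar>int (\<phi> u) - int (\<phi> v)\<bar> | u v. u \<in> pverts G \<and> v \<in> pverts G}"
  have "nat \<bar>int (\<phi> u) - int (\<phi> v)\<bar> \<le> N" if "u \<in> pverts G" "v \<in> pverts G" for u v
    using assms(3)[OF that(1)] assms(3)[OF that(2)] by linarith
  then have "d \<le> N" if "d \<in> ?S" for d using that by blast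
  moreover have "?S \<noteq> {}" using assms(2) by blast
  ultimately show ?thesis
    unfolding labeling_span_def using Max_le_iff[OF finite_abs_diffs[OF assms(1)]] by simp
qed

lemma radio_number_eqI:
  assumes "radio_labeling G \<psi>" "labeling_span G \<psi> \<le> N"
    and "\<And>\<phi>. radio_labeling G \<phi> \<Longrightarrow> N \<le> labeling_span G \<phi>"
  shows "radio_number G = N"
  unfolding radio_number_def
  by (rule Least_equality) (use assms order_antisym in blast)+

text \<open>Each vertex receives the value of \<open>g\<close> at one chosen time of visit, so it is
  enough that \<open>x\<close> covers the vertices. \<open>sep\<close> is additive to avoid
  truncated subtraction.\<close>

lemma radio_labeling_of_sequence:
  fixes x :: "nat \<Rightarrow> 'a"
  assumes fin: "finite (pverts G)" "pverts G \<noteq> {}"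
    and sym: "\<And>u v. u \<in> pverts G \<Longrightarrow> v \<in> pverts G \<Longrightarrow> graph_dist G u v = graph_dist G v u"
    and surj: "pverts G \<subseteq> x ` I"
    and sep: "\<And>i j. i \<in> I \<Longrightarrow> j \<in> I \<Longrightarrow> i < j \<Longrightarrow> x i \<noteq> x j \<Longrightarrow>
      x i \<in> pverts G \<Longrightarrow> x j \<in> pverts G \<Longrightarrow>
      g i + graph_diam G + 1 \<le> g j + graph_dist G (x i) (x j)"
    and le: "\<And>i. i \<in> I \<Longrightarrow> g i \<le> N"
  obtains \<phi> where "radio_labeling G \<phi>" "labeling_span G \<phi> \<le> N"
proof -
  define t where "t v = (SOME i. i \<in> I \<and> x i = v)" for v
  have t: "t v \<in> I" "x (t v) = v" if "v \<in> pverts G" for v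
  proof -
    have "\<exists>i. i \<in> I \<and> x i = v" using surj that by auto
    then have "t v \<in> I \<and> x (t v) = v" unfolding t_def by (rule someI_ex)
    then show "t v \<in> I" "x (t v) = v" by auto
  qed
  have "int (graph_dist G u v) + \<bar>int (g (t u)) - int (g (t v))\<bar> \<ge> int (graph_diam G) + 1"
    if uv: "u \<in> pverts G" "v \<in> pverts G" "u \<noteq> v" for u v
  proof -
    have "t u \<noteq> t v" using t uv by metis
    then consider "t u < t v" | "t v < t u" by linarith
    then show ?thesis
    proof cases
      case 1
      then show ?thesis using sep[of "t u" "t v"] t uv by fastforce
    next
      case 2
      then show ?thesis using sep[of "t v" "t u"] t uv sym[OF uv(1,2)] by fastforce
    qed
  qed
  then have "radio_labeling G (g \<circ> t)" by (simp add: radio_labeling_def)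
  moreover have "labeling_span G (g \<circ> t) \<le> N"
    using labeling_span_le[OF fin, of "g \<circ> t" N] t le by auto
  ultimately show thesis using that by blast
qed

section \<open>The product of a path and the Petersen graph\<close>

text \<open>Distance in the Petersen graph seen as a Kneser graph: disjoint pairs are adjacent, and
  two distinct pairs that meet have a common neighbour.\<close>

definition petersen_dist :: "nat set \<Rightarrow> nat set \<Rightarrow> nat" where
  "petersen_dist e f = (if e = f then 0 else if e \<inter> f = {} then 1 else 2)"

text \<open>Truncation makes one summand 0, so this is the absolute difference as a natural
  number.\<close>

definition layer_dist :: "nat \<Rightarrow> nat \<Rightarrow> nat" where
  "layer_dist i j = (i - j) + (j - i)"

lemma pverts_product: "pverts (path_graph n \<box> petersen_graph) = {..<n} \<times> pverts petersen_graph"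
  by (simp add: cartesian_product_def path_graph_def)

lemma pair_graph_product_petersen: "pair_graph (path_graph n \<box> petersen_graph)"
  by (intro pair_graph_product pair_graph_path pair_graph_petersen)

text \<open>The sum is a potential for \<open>graph_dist_eqI\<close>: an arc changes only one
  summand, by at most one. A descending arc leads along the path until the layer of \<open>v\<close>
  is reached, and then through the Petersen graph.\<close>

lemma graph_dist_product:
  assumes "u \<in> {..<n} \<times> pverts petersen_graph" "v \<in> {..<n} \<times> pverts petersen_graph"
  shows "graph_dist (path_graph n \<box> petersen_graph) u v
    = layer_dist (fst u) (fst v) + petersen_dist (snd u) (snd v)"
proof (rule graph_dist_eqI[OF pair_graph_product_petersen])
  show "u \<in> pverts (path_graph n \<box> petersen_graph)" "v \<in> pverts (path_graph n \<box> petersen_graph)"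
    using assms by (simp_all add: pverts_product)
  show "layer_dist (fst v) (fst v) + petersen_dist (snd v) (snd v) = 0"
    by (simp add: layer_dist_def petersen_dist_def)
next
  fix x y assume "(x, y) \<in> parcs (path_graph n \<box> petersen_graph)"
  then consider "fst x = fst y" "snd x \<inter> snd y = {}"
    | "snd x = snd y" "fst y = Suc (fst x) \<or> fst x = Suc (fst y)"
    unfolding cartesian_product_def path_graph_def parcs_petersen by auto
  then show "layer_dist (fst x) (fst v) + petersen_dist (snd x) (snd v)
      \<le> Suc (layer_dist (fst y) (fst v) + petersen_dist (snd y) (snd v))"
  proof cases
    case 1
    then have "petersen_dist (snd x) (snd v) \<le> Suc (petersen_dist (snd y) (snd v))"
      by (cases "snd y = snd v") (auto simp: petersen_dist_def)
    with 1 show ?thesis by simp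
  next
    case 2
    then show ?thesis by (auto simp: layer_dist_def)
  qed
next
  fix x assume x: "x \<in> pverts (path_graph n \<box> petersen_graph)" "x \<noteq> v"
  obtain i e j f where xv: "x = (i, e)" "v = (j, f)" by (cases x, cases v)
  have *: "i < n" "j < n" "e \<in> pverts petersen_graph" "f \<in> pverts petersen_graph"
    using x assms xv by (auto simp: pverts_product)
  show "\<exists>y. (x, y) \<in> parcs (path_graph n \<box> petersen_graph) \<and>
      layer_dist (fst x) (fst v) + petersen_dist (snd x) (snd v)
      = Suc (layer_dist (fst y) (fst v) + petersen_dist (snd y) (snd v))"
  proof (cases i j rule: linorder_cases)
    case less
    with * show ?thesis unfolding xv
      by (intro exI[of _ "(Suc i, e)"])
        (auto simp: cartesian_product_def path_graph_def layer_dist_def)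
  next
    case greater
    with * show ?thesis unfolding xv
      by (intro exI[of _ "(i - 1, e)"])
        (auto simp: cartesian_product_def path_graph_def layer_dist_def)
  next
    case equal
    then have "e \<noteq> f" using x xv by auto
    have arc: "((i, e), (i, g)) \<in> parcs (path_graph n \<box> petersen_graph)"
      if "(e, g) \<in> parcs petersen_graph" for g
      using that * by (auto simp: cartesian_product_def path_graph_def parcs_petersen)
    show ?thesis
    proof (cases "(e, f) \<in> parcs petersen_graph")
      case True
      with equal \<open>e \<noteq> f\<close> show ?thesis unfolding xv
        by (intro exI[of _ "(i, f)"]) (use arc[OF True] in \<open>auto simp: petersen_dist_def parcs_petersen\<close>)
    next
      case False
      then obtain g where g: "(e, g) \<in> parcs petersen_graph" "(g, f) \<in> parcs petersen_graph"
        using petersen_diam2[OF *(3,4)] \<open>e \<noteq> f\<close> by blast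
      then have "g \<noteq> f" using pair_graphD(2)[OF pair_graph_petersen] by blast
      with False g * equal \<open>e \<noteq> f\<close> show ?thesis unfolding xv
        by (intro exI[of _ "(i, g)"]) (use arc[OF g(1)] in \<open>auto simp: petersen_dist_def parcs_petersen\<close>)
    qed
  qed
qed

lemma graph_diam_product:
  assumes "n \<ge> 1"
  shows "graph_diam (path_graph n \<box> petersen_graph) = n + 1"
proof -
  let ?G = "path_graph n \<box> petersen_graph" and ?V = "{..<n} \<times> pverts petersen_graph"
  let ?S = "{graph_dist ?G u v | u v. u \<in> pverts ?G \<and> v \<in> pverts ?G}"
  have "?S = (\<lambda>(u, v). graph_dist ?G u v) ` (pverts ?G \<times> pverts ?G)" by auto
  then have "finite ?S" using pair_graphD(1)[OF pair_graph_product_petersen[of n]] by simp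
  moreover have "d \<le> n + 1" if "d \<in> ?S" for d
    using that by (auto simp: pverts_product graph_dist_product layer_dist_def petersen_dist_def)
  moreover have "n + 1 \<in> ?S"
  proof -
    \<comment> \<open>Opposite end layers and two distinct pairs that meet: distance
      \<open>n - 1\<close> plus 2.\<close>
    have uv: "(0, {0, 1}) \<in> ?V" "(n - 1, {0, 2}) \<in> ?V"
      using assms by (auto simp: pverts_petersen)
    have "graph_dist ?G (0, {0, 1}) (n - 1, {0, 2}) = n + 1"
      using assms by (subst graph_dist_product[OF uv])
        (auto simp: layer_dist_def petersen_dist_def doubleton_eq_iff)
    then show ?thesis unfolding pverts_product mem_Collect_eq using uv by metis
  qed
  ultimately show ?thesis unfolding graph_diam_def by (intro Max_eqI) auto
qed

lemma radio_labelingD_product: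
  assumes "radio_labeling (path_graph n \<box> petersen_graph) \<phi>" "n \<ge> 1"
    and uv: "u \<in> {..<n} \<times> pverts petersen_graph" "v \<in> {..<n} \<times> pverts petersen_graph" "u \<noteq> v"
  shows "int n + 2 \<le> \<bar>int (fst u) - int (fst v)\<bar> + int (petersen_dist (snd u) (snd v))
    + \<bar>int (\<phi> u) - int (\<phi> v)\<bar>"
proof -
  have "int (layer_dist (fst u) (fst v)) = \<bar>int (fst u) - int (fst v)\<bar>"
    by (auto simp: layer_dist_def)
  moreover have "int (graph_diam (path_graph n \<box> petersen_graph)) + 1
      \<le> int (graph_dist (path_graph n \<box> petersen_graph) u v) + \<bar>int (\<phi> u) - int (\<phi> v)\<bar>"
    using assms(1) uv unfolding radio_labeling_def pverts_product by blast
  ultimately show ?thesis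
    unfolding graph_dist_product[OF uv(1,2)] graph_diam_product[OF assms(2)] by simp
qed

section \<open>The lower bound\<close>

lemma inj_on_ordered_enumeration:
  fixes \<phi> :: "'a \<Rightarrow> nat"
  assumes "finite V" "inj_on \<phi> V"
  obtains x where "bij_betw x {..<card V} V"
    "\<And>i j. i < j \<Longrightarrow> j < card V \<Longrightarrow> \<phi> (x i) < \<phi> (x j)"
proof -
  have card: "card (\<phi> ` V) = card V" using assms by (simp add: card_image)
  obtain h where h: "bij_betw h {..<card V} (\<phi> ` V)" "strict_mono_on {..<card V} h"
    using ex_bij_betw_strict_mono_card[of "\<phi> ` V"] assms card by auto
  have "bij_betw (inv_into V \<phi>) (\<phi> ` V) V"
    using assms(2) by (simp add: bij_betw_inv_into inj_on_imp_bij_betw)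
  with h(1) have "bij_betw (inv_into V \<phi> \<circ> h) {..<card V} V" by (rule bij_betw_trans)
  moreover have "\<phi> ((inv_into V \<phi> \<circ> h) i) = h i" if "i < card V" for i
    using h(1) that by (auto simp: bij_betw_def intro!: f_inv_into_f)
  ultimately show thesis using that[of "inv_into V \<phi> \<circ> h"] h(2)
    by (fastforce simp: strict_mono_on_def)
qed

text \<open>The terms are twice the distances to the midpoint \<open>(n - 1) / 2\<close>, which
  keeps them integral. From \<open>n\<close> to \<open>n + 2\<close> two outer terms
  \<open>n + 1\<close> are added, and shifting the index by one leaves the others unchanged.\<close>

lemma sum_centre_distance:
  "(\<Sum>l<n. \<bar>2 * int l - (int n - 1)\<bar>) = int (n\<^sup>2 div 2)"
proof (induction n rule: induct_nat_012)
  case (ge2 n)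
  have "(\<Sum>l<Suc (Suc n). \<bar>2 * int l - (int (Suc (Suc n)) - 1)\<bar>)
      = (int n + 1) + (\<Sum>l<n. \<bar>2 * int l - (int n - 1)\<bar>) + (int n + 1)"
    by (subst sum.lessThan_Suc_shift) (simp add: algebra_simps)
  also have "\<dots> = int (n\<^sup>2 div 2 + 2 * n + 2)" using ge2 by simp
  also have "n\<^sup>2 div 2 + 2 * n + 2 = (Suc (Suc n))\<^sup>2 div 2"
  proof -
    have "(Suc (Suc n))\<^sup>2 = n\<^sup>2 + 2 * (2 * n + 2)" by (simp add: power2_eq_square)
    then show ?thesis by simp
  qed
  finally show ?case .
qed simp_all

text \<open>The two end positions belong to \<open>C\<close> and have only one neighbour each, whence the \<open>- 1\<close>.\<close>

lemma card_neighbours_le: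
  assumes "finite C" "0 \<in> C" "N - 1 \<in> C" "S \<subseteq> {..<N}"
    and "\<And>i. i \<in> S \<Longrightarrow> (\<exists>c\<in>C. i = Suc c \<or> c = Suc i)"
  shows "card S \<le> 2 * (card C - 1)"
proof -
  have "S \<subseteq> Suc ` (C - {N - 1}) \<union> (\<lambda>c. c - 1) ` (C - {0})"
  proof
    fix i assume "i \<in> S"
    with assms obtain c where c: "c \<in> C" "i = Suc c \<or> c = Suc i" "i < N" by blast
    from c(2) show "i \<in> Suc ` (C - {N - 1}) \<union> (\<lambda>c. c - 1) ` (C - {0})"
    proof
      assume "i = Suc c"
      then show ?thesis using c by auto
    next
      assume "c = Suc i"
      then have "i = c - 1" "c \<in> C - {0}" using c by auto
      then show ?thesis by blast
    qed
  qed
  then have "card S \<le> card (Suc ` (C - {N - 1}) \<union> (\<lambda>c. c - 1) ` (C - {0}))"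
    using assms(1) by (intro card_mono) auto
  also have "\<dots> \<le> card (Suc ` (C - {N - 1})) + card ((\<lambda>c. c - 1) ` (C - {0}))"
    by (rule card_Un_le)
  also have "\<dots> \<le> card (C - {N - 1}) + card (C - {0})"
    using assms(1) by (intro add_mono card_image_le) auto
  also have "\<dots> = 2 * (card C - 1)" using assms by simp
  finally show ?thesis .
qed

text \<open>Tightness of both steps forces \<open>a\<close> and \<open>c\<close> to the side of the centre \<open>k\<close> opposite to \<open>b\<close>;
  the two label gaps then add up to too little unless one of \<open>a\<close>, \<open>c\<close> is the centre.\<close>

lemma centre_next_to_extreme:
  fixes a b c f g k :: int
  assumes "0 \<le> a" "a \<le> 2 * k" "0 \<le> c" "c \<le> 2 * k" and b: "b = 0 \<or> b = 2 * k"
    and f: "2 * f = 2 * (2 * k + 1) - \<bar>2 * a - 2 * k\<bar> - \<bar>2 * b - 2 * k\<bar>"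
    and g: "2 * g = 2 * (2 * k + 1) - \<bar>2 * b - 2 * k\<bar> - \<bar>2 * c - 2 * k\<bar>"
    and "2 * k + 1 \<le> \<bar>a - b\<bar> + f" "2 * k + 1 \<le> \<bar>b - c\<bar> + g" "2 * k + 1 \<le> \<bar>a - c\<bar> + (f + g)"
  shows "a = k \<or> c = k"
  using b
proof
  assume b: "b = 0"
  have "\<bar>2 * b - 2 * k\<bar> = 2 * k" "\<bar>a - b\<bar> = a" "\<bar>b - c\<bar> = c" using b assms(1-4) by auto
  then have "\<bar>2 * a - 2 * k\<bar> = 2 * k + 2 - 2 * f" "\<bar>2 * c - 2 * k\<bar> = 2 * k + 2 - 2 * g"
    "2 * k + 1 \<le> a + f" "2 * k + 1 \<le> c + g" using assms by simp_all
  then have "a \<ge> k" "c \<ge> k" "f = 2 * k + 1 - a" "g = 2 * k + 1 - c" by linarith+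
  then show ?thesis using assms(10) by linarith
next
  assume b: "b = 2 * k"
  have "\<bar>2 * b - 2 * k\<bar> = 2 * k" "\<bar>a - b\<bar> = 2 * k - a" "\<bar>b - c\<bar> = 2 * k - c"
    using b assms(1-4) by auto
  then have "\<bar>2 * a - 2 * k\<bar> = 2 * k + 2 - 2 * f" "\<bar>2 * c - 2 * k\<bar> = 2 * k + 2 - 2 * g"
    "1 \<le> f - a" "1 \<le> g - c" using assms by simp_all
  then have "a \<le> k" "c \<le> k" "f = a + 1" "g = c + 1" by linarith+
  then show ?thesis using assms(10) by linarith
qed

lemma radio_labeling_span_ge:
  assumes radio: "radio_labeling (path_graph n \<box> petersen_graph) \<phi>" and n: "n \<ge> 3"
  shows "(if even n then 5 * (int n)\<^sup>2 - int n + 1 else 5 * (int n)\<^sup>2 - int n + 6)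
    \<le> int (labeling_span (path_graph n \<box> petersen_graph) \<phi>)"
proof -
  let ?G = "path_graph n \<box> petersen_graph"
  define V where "V = {..<n} \<times> pverts petersen_graph"
  have pv: "pverts ?G = V" by (simp add: V_def pverts_product)
  have fin: "finite V" using pair_graphD(1)[OF pair_graph_product_petersen[of n]] pv by simp
  have card: "card V = 10 * n" by (simp add: V_def card_cartesian_product card_petersen)
  have pd: "petersen_dist e f \<le> 2" for e f by (simp add: petersen_dist_def)
  \<comment> \<open>The Petersen distance, at most 2, is absorbed by the 2 in \<open>n + 2\<close>;
    from here on only layers matter.\<close>
  have gap: "int n \<le> \<bar>int (fst u) - int (fst v)\<bar> + \<bar>int (\<phi> u) - int (\<phi> v)\<bar>"
    if "u \<in> V" "v \<in> V" "u \<noteq> v" for u v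
    using radio_labelingD_product[OF radio, of u v] that n pd[of "snd u" "snd v"]
    unfolding V_def by linarith
  have inj: "inj_on \<phi> V"
  proof (rule inj_onI, rule ccontr)
    fix u v assume uv: "u \<in> V" "v \<in> V" "\<phi> u = \<phi> v" "u \<noteq> v"
    then have "fst u < n" "fst v < n" by (auto simp: V_def)
    then show False using gap[OF uv(1,2,4)] uv(3) by linarith
  qed
  obtain x where x: "bij_betw x {..<10 * n} V"
    and mono: "\<And>i j. i < j \<Longrightarrow> j < 10 * n \<Longrightarrow> \<phi> (x i) < \<phi> (x j)"
    using inj_on_ordered_enumeration[OF fin inj] card by metis
  define F where "F i = int (\<phi> (x i))" for i
  define l where "l i = int (fst (x i))" for i
  define A where "A i = \<bar>2 * l i - (int n - 1)\<bar>" for i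
  define M where "M = 10 * n - 1"
  have M: "Suc M = 10 * n" using n by (simp add: M_def)
  have xV: "x i \<in> V" if "i < 10 * n" for i using x that by (auto simp: bij_betw_def)
  have l: "0 \<le> l i" "l i < int n" if "i < 10 * n" for i
    using xV[OF that] by (auto simp: V_def l_def)
  have step: "int n \<le> \<bar>l i - l j\<bar> + (F j - F i)" if "i < j" "j < 10 * n" for i j
  proof -
    have "x i \<noteq> x j" using x that by (auto simp: bij_betw_def inj_on_def)
    then show ?thesis using gap[of "x i" "x j"] xV mono[OF that] that
      by (simp add: F_def l_def)
  qed
  \<comment> \<open>\<open>A i\<close> is twice the distance of layer \<open>l i\<close> from the
    middle. \<open>e i\<close> is twice the excess of the label gap over the bound through the
    middle, hence nonnegative by the triangle inequality.\<close>
  define e where "e i = 2 * (F (Suc i) - F i) - (2 * int n - A i - A (Suc i))" for i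
  have e_nonneg: "0 \<le> e i" if "i < M" for i
  proof -
    have "Suc i < 10 * n" using that M by linarith
    then show ?thesis using step[of i "Suc i"] unfolding e_def A_def by simp
  qed
  have sumA: "(\<Sum>i<10 * n. A i) = 10 * int (n\<^sup>2 div 2)"
  proof -
    have "(\<Sum>i<10 * n. A i) = (\<Sum>v\<in>V. \<bar>2 * int (fst v) - (int n - 1)\<bar>)"
      unfolding A_def l_def by (rule sum.reindex_bij_betw[OF x])
    also have "\<dots> = (\<Sum>j<n. \<Sum>p\<in>pverts petersen_graph. \<bar>2 * int j - (int n - 1)\<bar>)"
      unfolding V_def sum.cartesian_product by (simp add: case_prod_unfold)
    also have "\<dots> = 10 * int (n\<^sup>2 div 2)"
      by (simp add: card_petersen sum_distrib_left[symmetric] sum_centre_distance)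
    finally show ?thesis .
  qed
  \<comment> \<open>Interior positions contribute \<open>A\<close> twice, the two end positions only
    once, whence \<open>- A 0 - A M\<close>.\<close>
  have telescope: "(\<Sum>i<M. e i) = 2 * (F M - F 0) - 2 * int n * int M
      + 20 * int (n\<^sup>2 div 2) - A 0 - A M"
  proof -
    have "(\<Sum>i<m. e i) = 2 * (F m - F 0) - 2 * int n * int m
      + 2 * (\<Sum>i<Suc m. A i) - A 0 - A m" for m
      by (induction m) (simp_all add: e_def algebra_simps)
    from this[of M] show ?thesis unfolding M sumA by simp
  qed
  have span: "F M - F 0 \<le> int (labeling_span ?G \<phi>)"
    using le_labeling_span[of ?G "x M" "x 0" \<phi>] fin pv xV[of M] xV[of 0] M n
    unfolding F_def by auto
  have iM: "int M = 10 * int n - 1" using M by linarith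
  have e_sum: "0 \<le> (\<Sum>i<M. e i)" using e_nonneg by (intro sum_nonneg) auto
  have A_nonneg: "0 \<le> A i" for i by (simp add: A_def)
  show ?thesis
  proof (cases "even n")
    case True
    then obtain m where m: "n = 2 * m" by blast
    \<comment> \<open>For even \<open>n\<close> the middle lies between two layers; the two ends
      then contribute at least 2, which is the \<open>+ 1\<close> of the bound after
      halving.\<close>
    have "1 \<le> A i" for i unfolding A_def m by presburger
    then have "2 * int n * int M - 20 * int (n\<^sup>2 div 2) + 2 \<le> 2 * (F M - F 0)"
      using e_sum telescope by (smt (verit))
    moreover have "int (n\<^sup>2 div 2) = 2 * (int m)\<^sup>2" by (simp add: m power_mult_distrib)
    ultimately show ?thesis using True span unfolding iM
      by (simp add: m power2_eq_square algebra_simps)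
  next
    case False
    then obtain k where k: "n = 2 * k + 1" by (elim oddE)
    have sq: "int (n\<^sup>2 div 2) = 2 * int k * int k + 2 * int k"
    proof -
      have "n\<^sup>2 = 1 + 2 * (2 * k * k + 2 * k)" by (simp add: k power2_eq_square)
      then have "n\<^sup>2 div 2 = 2 * k * k + 2 * k" by simp
      then show ?thesis by simp
    qed
    \<comment> \<open>The bound that telescoping alone yields; excluding equality raises it by
      one.\<close>
    define B where "B = 5 * (int n)\<^sup>2 - int n + 5"
    have tele': "(\<Sum>i<M. e i) + A 0 + A M = 2 * (F M - F 0) - 2 * B"
      unfolding telescope iM sq B_def by (simp add: k power2_eq_square algebra_simps)
    have "F M - F 0 \<noteq> B"
    proof
      assume "F M - F 0 = B"
      then have "(\<Sum>i<M. e i) + A 0 + A M = 0" using tele' by simp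
      then have zero: "(\<Sum>i<M. e i) = 0" "A 0 = 0" "A M = 0"
        using e_sum A_nonneg[of 0] A_nonneg[of M] by (smt (verit))+
      then have e0: "e i = 0" if "i < M" for i
        using that e_nonneg by (subst (asm) sum_nonneg_eq_0_iff) auto
      define C where "C = {i. i < 10 * n \<and> l i = int k}"
      define S where "S = {i. i < 10 * n \<and> (l i = 0 \<or> l i = int n - 1)}"
      have fiber: "card {i. i < 10 * n \<and> fst (x i) \<in> L} = 10 * card L" if "L \<subseteq> {..<n}" for L
      proof -
        have "bij_betw x {i. i < 10 * n \<and> fst (x i) \<in> L} (L \<times> pverts petersen_graph)"
        proof (rule bij_betw_subset[OF x])
          have "x ` {i. i < 10 * n \<and> fst (x i) \<in> L} = {v \<in> x ` {..<10 * n}. fst v \<in> L}"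
            by auto
          also have "x ` {..<10 * n} = V" using x by (simp add: bij_betw_def)
          also have "{v \<in> V. fst v \<in> L} = L \<times> pverts petersen_graph"
            using that unfolding V_def by auto
          finally show "x ` {i. i < 10 * n \<and> fst (x i) \<in> L} = L \<times> pverts petersen_graph" .
        qed auto
        then show ?thesis
          using bij_betw_same_card by (fastforce simp: card_cartesian_product card_petersen)
      qed
      have "C = {i. i < 10 * n \<and> fst (x i) \<in> {k}}" by (auto simp: C_def l_def)
      then have cardC: "card C = 10" using fiber[of "{k}"] k by simp
      have "S = {i. i < 10 * n \<and> fst (x i) \<in> {0, n - 1}}" using n by (auto simp: S_def l_def)
      then have cardS: "card S = 20" using fiber[of "{0, n - 1}"] n by simp
      have ends: "0 \<in> C" "M \<in> C" using zero M n unfolding C_def A_def k by auto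
      have "\<exists>c\<in>C. i = Suc c \<or> c = Suc i" if "i \<in> S" for i
      proof -
        have lk: "l 0 = int k" "l M = int k" using ends by (auto simp: C_def)
        have li: "i < 10 * n" "l i = 0 \<or> l i = int n - 1" using that by (auto simp: S_def)
        \<comment> \<open>As \<open>n \<ge> 3\<close>, an outermost layer is not the centre, so
          position \<open>i\<close> is not an end and has neighbours on both sides.\<close>
        then have "l i \<noteq> int k" using n k by auto
        then have "i \<noteq> 0" "i \<noteq> M" using lk by metis+
        then obtain h where h: "i = Suc h" "Suc h < M" using li(1) M by (cases i) auto
        have s: "int n \<le> \<bar>l h - l (Suc h)\<bar> + (F (Suc h) - F h)"
          "int n \<le> \<bar>l (Suc h) - l (Suc (Suc h))\<bar> + (F (Suc (Suc h)) - F (Suc h))"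
          "int n \<le> \<bar>l h - l (Suc (Suc h))\<bar> + (F (Suc (Suc h)) - F h)"
          using h M by (intro step; simp)+
        have z: "e h = 0" "e (Suc h) = 0" using e0 h by auto
        have b: "0 \<le> l h" "l h \<le> 2 * int k" "0 \<le> l (Suc (Suc h))" "l (Suc (Suc h)) \<le> 2 * int k"
          using l[of h] l[of "Suc (Suc h)"] h M k by auto
        have "l h = int k \<or> l (Suc i) = int k"
        proof (rule centre_next_to_extreme)
          show "l i = 0 \<or> l i = 2 * int k" using li(2) k by simp
          show "2 * (F i - F h) = 2 * (2 * int k + 1) - \<bar>2 * l h - 2 * int k\<bar> - \<bar>2 * l i - 2 * int k\<bar>"
            "2 * (F (Suc i) - F i)
              = 2 * (2 * int k + 1) - \<bar>2 * l i - 2 * int k\<bar> - \<bar>2 * l (Suc i) - 2 * int k\<bar>"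
            using z unfolding e_def A_def h k by simp_all
        qed (use s b h k in auto)
        then have "h \<in> C \<or> Suc i \<in> C" using h M by (auto simp: C_def)
        then show ?thesis using h by blast
      qed
      then have "card S \<le> 2 * (card C - 1)"
        using ends M by (intro card_neighbours_le[of C "10 * n"]) (auto simp: C_def S_def M_def)
      then show False using cardC cardS by simp
    qed
    moreover have "0 \<le> 2 * (F M - F 0) - 2 * B"
      unfolding tele'[symmetric] using e_sum A_nonneg by (intro add_nonneg_nonneg)
    ultimately show ?thesis using False span unfolding B_def by auto
  qed
qed

section \<open>Optimal labelings\<close>

text \<open>
  Each column lists all ten vertices of the Petersen graph; entry \<open>r\<close> is the one to be used in
  round \<open>r\<close>. The columns were found by computer search. Even \<open>n\<close> uses columns 0 and 1
  alternately; for odd \<open>n\<close> the columns 0, 1, 2, 3 are repeated cyclically within a round, which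
  ends with column 4.
\<close>

definition petersen_cols :: "nat set list list" where
  "petersen_cols =
    [[{1,2},{2,3},{1,3},{3,4},{0,4},{0,3},{0,2},{2,4},{1,4},{0,1}],
     [{2,4},{1,2},{2,3},{0,3},{0,2},{0,1},{0,4},{3,4},{1,3},{1,4}],
     [{2,3},{0,2},{3,4},{0,4},{2,4},{1,3},{0,3},{1,4},{0,1},{1,2}],
     [{0,2},{0,3},{1,4},{2,4},{3,4},{2,3},{0,1},{1,2},{0,4},{1,3}],
     [{0,4},{0,1},{2,4},{0,2},{2,3},{1,2},{1,4},{1,3},{0,3},{3,4}]]"

definition pcol :: "nat \<Rightarrow> nat \<Rightarrow> nat set" where
  "pcol c r = petersen_cols ! c ! r"

text \<open>Ensures that a layer served by a single column is exhausted over the ten rounds.\<close>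

lemma pcol_image:
  assumes "c < 5"
  shows "pcol c ` {..<10} = pverts petersen_graph"
proof -
  have "\<forall>c\<in>{..<5}. pcol c ` {..<10}
      = {{0,1},{0,2},{0,3},{0,4},{1,2},{1,3},{1,4},{2,3},{2,4},{3,4}}"
    by code_simp
  then show ?thesis using assms by (simp add: pverts_petersen)
qed

text \<open>What the ordering for even \<open>n\<close> needs: entries one or two steps apart are
  nonadjacent and distinct. The \<open>mod 10\<close> covers the passage to the next pair of layers,
  where the columns start again.\<close>

lemma pcol_cyclic:
  "\<forall>r\<in>{..<10}. petersen_dist (pcol 0 r) (pcol 1 r) = 2 \<and>
    petersen_dist (pcol 1 r) (pcol 0 (Suc r mod 10)) = 2 \<and>
    petersen_dist (pcol 0 r) (pcol 0 (Suc r mod 10)) = 2 \<and>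
    petersen_dist (pcol 1 r) (pcol 1 (Suc r mod 10)) = 2"
  by code_simp

text \<open>What a round for odd \<open>n\<close> needs: Petersen distance 2 for one step, distinct
  entries for two steps. The final position \<open>2 * k\<close> is even, so column 4 comes right
  after column 1 or 3, and two steps after column 0 or 2.\<close>

lemma pcol_round:
  "\<forall>r\<in>{..<10}. petersen_dist (pcol 0 r) (pcol 1 r) = 2 \<and>
    petersen_dist (pcol 1 r) (pcol 2 r) = 2 \<and> petersen_dist (pcol 2 r) (pcol 3 r) = 2 \<and>
    petersen_dist (pcol 3 r) (pcol 0 r) = 2 \<and> petersen_dist (pcol 1 r) (pcol 4 r) = 2 \<and>
    petersen_dist (pcol 3 r) (pcol 4 r) = 2 \<and>
    pcol 0 r \<noteq> pcol 2 r \<and> pcol 1 r \<noteq> pcol 3 r \<and> pcol 0 r \<noteq> pcol 4 r \<and> pcol 2 r \<noteq> pcol 4 r"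
  by code_simp

text \<open>Column 0 serves the centre layer. In round 1 that layer is skipped, and the missing entry
  \<open>pcol 0 1\<close> is visited at the very end, as round 10.\<close>

definition round0 :: "nat \<Rightarrow> nat" where
  "round0 r = (if r = 10 then 1 else r)"

text \<open>The passage from a round, ending in column 4, to the centre layer in the next one. Round
  0 is left out because the centre visit after it is skipped.\<close>

lemma pcol_next_round:
  "\<forall>r\<in>{1..<10}. petersen_dist (pcol 4 r) (pcol 0 (round0 (Suc r))) = 2 \<and>
    pcol 1 r \<noteq> pcol 0 (round0 (Suc r)) \<and> pcol 3 r \<noteq> pcol 0 (round0 (Suc r))"
  by code_simp

text \<open>The entries at times \<open>n - 2\<close> and \<open>n - 1\<close> against those at
  \<open>n + 1\<close> and \<open>n + 2\<close>. The alternatives reflect the columns that can stand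
  at times \<open>n - 2\<close> (1 or 3) and \<open>n + 2\<close> (2, or 4 if
  \<open>k = 1\<close>).\<close>

lemma pcol_skip:
  "petersen_dist (pcol 1 0) (pcol 1 1) = 2" "petersen_dist (pcol 3 0) (pcol 1 1) = 2"
  "petersen_dist (pcol 4 0) (pcol 2 1) = 2" "petersen_dist (pcol 4 0) (pcol 4 1) = 2"
  "pcol 4 0 \<noteq> pcol 1 1"
  by code_simp+

lemma petersen_dist_pos: "e \<noteq> f \<Longrightarrow> 1 \<le> petersen_dist e f"
  by (simp add: petersen_dist_def)

text \<open>The last premise of \<open>sep\<close> says that the two vertices differ, phrased as a
  bound that linear arithmetic can use directly.\<close>

lemma radio_labeling_product_of_sequence:
  fixes x :: "nat \<Rightarrow> nat \<times> nat set"
  assumes n: "n \<ge> 1"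
    and surj: "\<And>l e. l < n \<Longrightarrow> e \<in> pverts petersen_graph \<Longrightarrow> \<exists>i\<in>I. x i = (l, e)"
    and sep: "\<And>i j. i \<in> I \<Longrightarrow> j \<in> I \<Longrightarrow> i < j \<Longrightarrow>
      1 \<le> layer_dist (fst (x i)) (fst (x j)) + petersen_dist (snd (x i)) (snd (x j)) \<Longrightarrow>
      g i + n + 2 \<le>
        g j + (layer_dist (fst (x i)) (fst (x j)) + petersen_dist (snd (x i)) (snd (x j)))"
    and le: "\<And>i. i \<in> I \<Longrightarrow> g i \<le> N"
  obtains \<phi> where "radio_labeling (path_graph n \<box> petersen_graph) \<phi>"
    "labeling_span (path_graph n \<box> petersen_graph) \<phi> \<le> N"
proof -
  let ?G = "path_graph n \<box> petersen_graph"
  have pv: "pverts ?G = {..<n} \<times> pverts petersen_graph" by (rule pverts_product)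
  show thesis
  proof (rule radio_labeling_of_sequence[of ?G x I g N])
    show "finite (pverts ?G)" by (rule pair_graphD(1)[OF pair_graph_product_petersen])
    have "(0, {0, 1}) \<in> pverts ?G" using n by (simp add: pv pverts_petersen)
    then show "pverts ?G \<noteq> {}" by blast
    show "pverts ?G \<subseteq> x ` I"
    proof
      fix v assume "v \<in> pverts ?G"
      then have "\<exists>i\<in>I. x i = v" using surj[of "fst v" "snd v"] by (auto simp: pv)
      then show "v \<in> x ` I" by blast
    qed
    show "graph_dist ?G u v = graph_dist ?G v u" if "u \<in> pverts ?G" "v \<in> pverts ?G" for u v
      using that unfolding pv
      by (simp add: graph_dist_product layer_dist_def petersen_dist_def Int_commute)
    show "g i + graph_diam ?G + 1 \<le> g j + graph_dist ?G (x i) (x j)"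
      if "i \<in> I" "j \<in> I" "i < j" "x i \<noteq> x j" "x i \<in> pverts ?G" "x j \<in> pverts ?G" for i j
    proof -
      have "1 \<le> layer_dist (fst (x i)) (fst (x j)) + petersen_dist (snd (x i)) (snd (x j))"
        using that(4) by (auto simp: layer_dist_def petersen_dist_def prod_eq_iff)
      from sep[OF that(1-3) this] show ?thesis
        using that(5,6) n by (simp add: pv graph_dist_product graph_diam_product)
    qed
  qed (use le that in auto)
qed

text \<open>
  The sequence \<open>x\<close> alternates between layers \<open>m - 1 - b\<close> and \<open>2 * m - 1 - b\<close> for 20 steps and
  then increases \<open>b\<close>. It starts and ends next to the middle of the path.
\<close>

lemma even_labeling:
  assumes n: "n = 2 * m" and m: "m \<ge> 2"
  obtains \<phi> where "radio_labeling (path_graph n \<box> petersen_graph) \<phi>"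
    "labeling_span (path_graph n \<box> petersen_graph) \<phi> \<le> 20 * m * m - 2 * m + 1"
proof -
  define x where "x i = (if even i then (m - 1 - i div 2 div 10, pcol 0 (i div 2 mod 10))
    else (2 * m - 1 - i div 2 div 10, pcol 1 (i div 2 mod 10)))" for i
  \<comment> \<open>A step between layers at distance \<open>m\<close> costs \<open>m\<close>;
    entering the next pair of layers is a step of distance \<open>m + 1\<close> and saves
    one.\<close>
  define g where "g i = m * i - i div 20" for i
  \<comment> \<open>Makes the subtraction in \<open>g\<close> exact.\<close>
  have div20: "i div 20 \<le> m * i" for i
  proof -
    have "i div 20 \<le> i" by simp
    also have "\<dots> \<le> m * i" using m by simp
    finally show ?thesis .
  qed
  have x_even: "x (2 * q) = (m - 1 - q div 10, pcol 0 (q mod 10))"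
    and x_odd: "x (2 * q + 1) = (2 * m - 1 - q div 10, pcol 1 (q mod 10))" for q
    by (simp_all add: x_def)
  have half_div: "2 * q div 20 = q div 10" "(2 * q + 1) div 20 = q div 10" for q :: nat
    by linarith+
  have g_even: "g (2 * q) + q div 10 = m * (2 * q)"
    and g_odd: "g (2 * q + 1) + q div 10 = m * (2 * q + 1)" for q
    using div20[of "2 * q"] div20[of "2 * q + 1"] half_div[of q] by (simp_all add: g_def)
  show thesis
  proof (rule radio_labeling_product_of_sequence[of n "{..<20 * m}" x g])
    show "1 \<le> n" using n m by simp
  next
    fix l :: nat and e assume l: "l < n" and e: "e \<in> pverts petersen_graph"
    obtain r where r: "r < 10" "e = pcol (if l < m then 0 else 1) r"
      using e pcol_image[of "if l < m then 0 else 1", symmetric] by auto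
    show "\<exists>i\<in>{..<20 * m}. x i = (l, e)"
    proof (cases "l < m")
      case True
      let ?q = "10 * (m - 1 - l) + r"
      have "?q div 10 = m - 1 - l" "?q mod 10 = r" using r by simp_all
      then have "x (2 * ?q) = (l, e)" unfolding x_even using True r by simp
      moreover have "2 * ?q < 20 * m" using less_imp_Suc_add[OF True] r(1) by auto
      ultimately show ?thesis by blast
    next
      case False
      let ?q = "10 * (2 * m - 1 - l) + r"
      have "?q div 10 = 2 * m - 1 - l" "?q mod 10 = r" using r by simp_all
      then have "x (2 * ?q + 1) = (l, e)" unfolding x_odd using False l n r by simp
      moreover have "2 * ?q + 1 < 20 * m"
      proof -
        obtain d where "2 * m = Suc (l + d)" using less_imp_Suc_add l n by blast
        then have "2 * m - 1 - l = d" "d < m" using False by linarith+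
        then show ?thesis using r(1) by simp
      qed
      ultimately show ?thesis by blast
    qed
  next
    fix i j :: nat
    let ?d = "layer_dist (fst (x i)) (fst (x j)) + petersen_dist (snd (x i)) (snd (x j))"
    assume ij: "i \<in> {..<20 * m}" "j \<in> {..<20 * m}" "i < j" and d: "1 \<le> ?d"
    show "g i + n + 2 \<le> g j + ?d"
    proof (cases "j \<ge> i + 4")
      case True
      define D where "D = j - i"
      have D: "j = i + D" "D \<ge> 4" using True by (simp_all add: D_def)
      have "j div 20 \<le> i div 20 + (D - 3)" using D by linarith
      moreover have "m * j = m * i + m * D" by (simp add: D algebra_simps)
      moreover have "m * D + 3 \<ge> 2 * m + 1 + D"
      proof -
        obtain m' D' where "m = m' + 2" "D = D' + 4"
          using m D by (metis add.commute le_Suc_ex)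
        then show ?thesis by (simp add: algebra_simps)
      qed
      ultimately show ?thesis
        using d D div20[of i] div20[of j] n unfolding g_def by linarith
    next
      case False
      define q where "q = i div 2"
      define b where "b = q div 10"
      have tab: "petersen_dist (pcol 0 (q mod 10)) (pcol 1 (q mod 10)) = 2"
        "petersen_dist (pcol 1 (q mod 10)) (pcol 0 ((q + 1) mod 10)) = 2"
        "petersen_dist (pcol 0 (q mod 10)) (pcol 0 ((q + 1) mod 10)) = 2"
        "petersen_dist (pcol 1 (q mod 10)) (pcol 1 ((q + 1) mod 10)) = 2"
        using pcol_cyclic[THEN bspec, of "q mod 10"] by (simp_all add: mod_Suc_eq)
      have b1: "(q + 1) div 10 = b \<or> (q + 1) div 10 = b + 1"
        and b2: "(q + 2) div 10 = b \<or> (q + 2) div 10 = b + 1"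
        unfolding b_def by linarith+
      \<comment> \<open>Keeps the subtractions in the layer numbers from being truncated.\<close>
      have bm: "j div 20 < m" using ij(2) by (simp add: less_mult_imp_div_less mult.commute)
      have "i = 2 * q \<or> i = 2 * q + 1" unfolding q_def by linarith
      moreover have "j = i + 1 \<or> j = i + 2 \<or> j = i + 3" using ij(3) False by linarith
      ultimately consider
        "i = 2 * q" "j = 2 * q + 1" | "i = 2 * q" "j = 2 * (q + 1)"
        | "i = 2 * q" "j = 2 * (q + 1) + 1" | "i = 2 * q + 1" "j = 2 * (q + 1)"
        | "i = 2 * q + 1" "j = 2 * (q + 1) + 1" | "i = 2 * q + 1" "j = 2 * (q + 2)"
        by (elim disjE) auto
      then show ?thesis
      proof cases
        case 1
        have "b < m" using bm by (simp only: 1 half_div b_def)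
        then show ?thesis using tab g_even[of q] g_odd[of q] m unfolding 1 x_even x_odd
          by (simp add: layer_dist_def b_def[symmetric] n algebra_simps)
      next
        case 2
        have "(q + 1) div 10 < m" using bm by (simp only: 2 half_div)
        then show ?thesis using tab b1 g_even[of q] g_even[of "q + 1"] m unfolding 2 x_even
          by (auto simp: layer_dist_def b_def[symmetric] n algebra_simps; linarith)
      next
        case 3
        have "(q + 1) div 10 < m" using bm by (simp only: 3 half_div)
        then show ?thesis using tab b1 g_even[of q] g_odd[of "q + 1"] m unfolding 3 x_even x_odd
          by (auto simp: layer_dist_def b_def[symmetric] n algebra_simps; linarith)
      next
        case 4
        have "(q + 1) div 10 < m" using bm by (simp only: 4 half_div)
        then show ?thesis using tab b1 g_odd[of q] g_even[of "q + 1"] m unfolding 4 x_even x_odd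
          by (auto simp: layer_dist_def b_def[symmetric] n algebra_simps; linarith)
      next
        case 5
        have "(q + 1) div 10 < m" using bm by (simp only: 5 half_div)
        then show ?thesis using tab b1 g_odd[of q] g_odd[of "q + 1"] m unfolding 5 x_odd
          by (auto simp: layer_dist_def b_def[symmetric] n algebra_simps; linarith)
      next
        case 6
        have "(q + 2) div 10 < m" using bm by (simp only: 6 half_div)
        then show ?thesis using b2 g_odd[of q] g_even[of "q + 2"] m unfolding 6 x_even x_odd
          by (auto simp: layer_dist_def b_def[symmetric] n algebra_simps; linarith)
      qed
    qed
  next
    fix i assume "i \<in> {..<20 * m}"
    \<comment> \<open>\<open>D\<close> counts the times after \<open>i\<close>; the bound is
      attained at \<open>D = 0\<close>.\<close>
    then obtain D where D: "20 * m = i + 1 + D"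
      by (metis lessThan_iff less_iff_Suc_add add.assoc add.commute Suc_eq_plus1)
    have "m * (20 * m) = m * i + m + m * D" unfolding D by (simp add: algebra_simps)
    moreover have "m \<le> i div 20 + 1 + D" using D by linarith
    moreover have "D \<le> m * D" using m by simp
    moreover have "20 * m * m = m * (20 * m)" by simp
    ultimately show "g i \<le> 20 * m * m - 2 * m + 1" unfolding g_def by linarith
  qed (use that in auto)
qed

text \<open>
  Time \<open>t = n * r + s\<close> is position \<open>s\<close> of round \<open>r\<close>; a round visits the layers
  \<open>k, 2k, k - 1, 2k - 1, \<dots>, 1, k + 1, 0\<close>. Time \<open>n\<close> is skipped and time \<open>10 * n\<close> added, so that
  the outermost layers \<open>0\<close> and \<open>2k\<close> meet at the skip, where the labels drop by \<open>2 * k\<close> against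
  the regular pattern \<open>H\<close>. The term \<open>E\<close> counts the steps between layers at distance \<open>k\<close>, which
  cost \<open>k + 1\<close> instead of \<open>k\<close>.
\<close>

lemma odd_labeling:
  assumes n: "n = 2 * k + 1" and k: "k \<ge> 1"
  obtains \<phi> where "radio_labeling (path_graph n \<box> petersen_graph) \<phi>"
    "labeling_span (path_graph n \<box> petersen_graph) \<phi> \<le> 20 * k * k + 18 * k + 10"
proof -
  define lay where "lay s = (if even s then k - s div 2 else 2 * k - s div 2)" for s
  define p where "p r s = pcol (if s = 2 * k then 4 else s mod 4) (round0 r)" for r s
  define x where "x t = (lay (t mod n), p (t div n) (t mod n))" for t
  \<comment> \<open>This is the number of even positions before time \<open>t\<close>: a round has
    \<open>k + 1\<close> of them, and exactly the steps leaving an even position have layer distance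
    \<open>k\<close>.\<close>
  define E where "E t = (t div n) * (k + 1) + (t mod n + 1) div 2" for t
  define H where "H t = k * t + E t" for t
  define g where "g t = H t - (if t > n then 2 * k else 0)" for t
  let ?d = "\<lambda>i j. layer_dist (fst (x i)) (fst (x j)) + petersen_dist (snd (x i)) (snd (x j))"
  have n0: "n > 0" using n by simp
  have x_at: "x (n * r + s) = (lay s, p r s)" and E_at: "E (n * r + s) = r * (k + 1) + (s + 1) div 2"
    if "s \<le> 2 * k" for r s
  proof -
    have "s < n" using that n by simp
    then have "(n * r + s) div n = r" "(n * r + s) mod n = s" by simp_all
    then show "x (n * r + s) = (lay s, p r s)" "E (n * r + s) = r * (k + 1) + (s + 1) div 2"
      by (simp_all add: x_def E_def)
  qed
  have decomp: "\<exists>r s. t = n * r + s \<and> s \<le> 2 * k" for t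
  proof -
    have "t = n * (t div n) + t mod n" by simp
    moreover have "t mod n \<le> 2 * k" using mod_less_divisor[OF n0, of t] n by linarith
    ultimately show ?thesis by blast
  qed
  have wrap: "Suc (n * r + 2 * k) = n * Suc r + 0" for r using n by simp
  have E_step: "E (Suc (n * r + s)) = E (n * r + s) + (if even s then 1 else 0)" if "s \<le> 2 * k" for r s
  proof (cases "s = 2 * k")
    case True
    then show ?thesis unfolding True wrap by (subst (1 2) E_at) auto
  next
    case False
    then have "E (n * r + Suc s) = r * (k + 1) + (Suc s + 1) div 2" using that by (intro E_at) simp
    then show ?thesis using E_at[OF that, of r] by auto
  qed
  have x_wrap: "x (Suc (n * r + 2 * k)) = (lay 0, p (Suc r) 0)"
    and E_wrap: "E (Suc (Suc (n * r + 2 * k))) = E (Suc (n * r + 2 * k)) + 1" for r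
    unfolding wrap using x_at[of 0 "Suc r"] E_step[of 0 "Suc r"] by simp_all
  have E_Suc: "E t \<le> E (Suc t)" for t
    using decomp[of t] E_step by auto
  have E_mono: "E i \<le> E j" if "i \<le> j" for i j
    using E_Suc that by (rule lift_Suc_mono_le)
  \<comment> \<open>Of two consecutive positions at least one is even; at the end of a round both
    \<open>2 * k\<close> and the following 0 are.\<close>
  have E_two: "E t + 1 \<le> E (t + 2)" for t
  proof -
    obtain r s where t: "t = n * r + s" "s \<le> 2 * k" using decomp by blast
    show ?thesis
    proof (cases "even s")
      case True
      then show ?thesis using E_step[OF t(2), of r] E_Suc[of "Suc t"] t by simp
    next
      case False
      then have "s < 2 * k" using t(2) by (metis dvd_triv_left le_neq_implies_less)
      then have "E (Suc (n * r + Suc s)) = E (n * r + Suc s) + 1" using False E_step[of "Suc s" r] by simp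
      then show ?thesis using E_Suc[of t] t by simp
    qed
  qed

  \<comment> \<open>Petersen entries at nearby times\<close>
  have round0: "round0 r = r" "round0 r \<in> {..<10}" if "r < 10" for r
    using that by (auto simp: round0_def)
  have odd_mod4: "s mod 4 = 1 \<or> s mod 4 = 3" if "odd s" for s :: nat
    using that by presburger
  have p_step: "petersen_dist (p r s) (p r (Suc s)) = 2" if "r < 10" "s < 2 * k" for r s
  proof (cases "Suc s = 2 * k")
    case True
    then have "s mod 4 = 1 \<or> s mod 4 = 3" by presburger
    moreover have "p r (Suc s) = pcol 4 r" using True round0 that by (simp add: p_def)
    ultimately show ?thesis using that pcol_round[THEN bspec, of r] round0[of r]
      by (elim disjE) (simp_all add: p_def)
  next
    case False
    have "s mod 4 = 0 \<and> Suc s mod 4 = 1 \<or> s mod 4 = 1 \<and> Suc s mod 4 = 2 \<or>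
      s mod 4 = 2 \<and> Suc s mod 4 = 3 \<or> s mod 4 = 3 \<and> Suc s mod 4 = 0"
      by presburger
    then show ?thesis
      using False that pcol_round[THEN bspec, of r] round0[of r]
      by (elim disjE conjE) (simp_all add: p_def)
  qed
  have p_two: "p r s \<noteq> p r (s + 2)" if "r < 10" "s + 2 \<le> 2 * k" for r s
  proof (cases "s + 2 = 2 * k")
    case True
    then have "s mod 4 = 0 \<or> s mod 4 = 2" "s \<noteq> 2 * k" by presburger+
    moreover have "p r (s + 2) = pcol 4 r" using True round0 that by (simp add: p_def)
    ultimately show ?thesis using that pcol_round[THEN bspec, of r] round0[of r]
      by (elim disjE) (simp_all add: p_def)
  next
    case False
    have "s mod 4 = 0 \<and> (s + 2) mod 4 = 2 \<or> s mod 4 = 1 \<and> (s + 2) mod 4 = 3 \<or>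
      s mod 4 = 2 \<and> (s + 2) mod 4 = 0 \<or> s mod 4 = 3 \<and> (s + 2) mod 4 = 1"
      by presburger
    moreover have "pcol 2 r \<noteq> pcol 0 r" "pcol 3 r \<noteq> pcol 1 r"
      using pcol_round[THEN bspec, of r] that by (metis lessThan_iff)+
    ultimately show ?thesis
      using False that pcol_round[THEN bspec, of r] round0[of r]
      by (elim disjE conjE) (simp_all add: p_def)
  qed
  have p_wrap: "petersen_dist (p r (2 * k)) (p (Suc r) 0) = 2" "p r (2 * k - 1) \<noteq> p (Suc r) 0"
    if "1 \<le> r" "r < 10" for r
  proof -
    note tab = pcol_next_round[THEN bspec, of r] round0[of r]
    show "petersen_dist (p r (2 * k)) (p (Suc r) 0) = 2"
      using tab that k by (simp add: p_def)
    have "(2 * k - 1) mod 4 = 1 \<or> (2 * k - 1) mod 4 = 3" using odd_mod4 k by simp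
    moreover have "2 * k - 1 \<noteq> 2 * k" using k by simp
    ultimately show "p r (2 * k - 1) \<noteq> p (Suc r) 0"
      using tab that k by (elim disjE) (simp_all add: p_def)
  qed

  \<comment> \<open>Pairs of times on the same side of the skip\<close>
  have same_side: "H i + n + 2 \<le> H j + ?d i j"
    if ij: "i < j" "j \<le> 10 * n" "i > n \<or> j < n" and d: "1 \<le> ?d i j" for i j
  proof -
    obtain r s where i: "i = n * r + s" "s \<le> 2 * k" using decomp by blast
    have "n * r < n * 10" using i ij by linarith
    then have r10: "r < 10" by simp
    \<comment> \<open>A pair leaving round 0 would have \<open>j \<ge> n\<close> with
      \<open>i < n\<close>, contrary to both lying on one side; so \<open>p_wrap\<close> is only
      called from round 1 on.\<close>
    have r1: "1 \<le> r" if "s + 2 > 2 * k" "j \<noteq> i + 1 \<or> s = 2 * k"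
    proof (rule ccontr)
      assume "\<not> 1 \<le> r"
      then have "i = s" using i(1) by simp
      then show False using that ij i(2) n by linarith
    qed
    consider "j = Suc i" | "j = i + 2" | "j \<ge> i + 3" using ij(1) by linarith
    then show ?thesis
    proof cases
      case 1
      show ?thesis
      proof (cases "s = 2 * k")
        case True
        have "x j = (lay 0, p (Suc r) 0)" using x_wrap[of r] 1 i True by simp
        moreover have "E j = E i + 1" using E_step[OF i(2), of r] 1 i True by simp
        ultimately show ?thesis
          using p_wrap[OF r1 r10] 1 i x_at[OF i(2), of r] n True
          by (simp add: H_def lay_def layer_dist_def)
      next
        case False
        then have "x j = (lay (Suc s), p r (Suc s))" using x_at[of "Suc s" r] 1 i by simp
        moreover have "E j = E i + (if even s then 1 else 0)" using E_step[OF i(2), of r] 1 i by simp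
        moreover have "s < 2 * k" using False i by simp
        moreover have "layer_dist (lay s) (lay (Suc s)) = (if even s then k else k + 1)"
          using \<open>s < 2 * k\<close> by (auto simp: lay_def layer_dist_def elim!: evenE oddE)
        ultimately show ?thesis
          using p_step[OF r10] 1 i(1) x_at[OF i(2), of r] n by (auto simp: H_def)
      qed
    next
      case 2
      have Hj: "H j + E i = H i + 2 * k + E j" "E i + 1 \<le> E j"
        using E_two[of i] 2 by (simp_all add: H_def)
      consider "s + 2 \<le> 2 * k" | "s + 1 = 2 * k" | "s = 2 * k" using i(2) by linarith
      then show ?thesis
      proof cases
        case 1
        then have "x j = (lay (s + 2), p r (s + 2))" using x_at[of "s + 2" r] 2 i by simp
        moreover have "layer_dist (lay s) (lay (s + 2)) = 1"
          using 1 by (auto simp: lay_def layer_dist_def elim!: evenE oddE)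
        ultimately show ?thesis
          using Hj petersen_dist_pos[OF p_two[OF r10 1]] x_at[OF i(2), of r] i(1) n by simp
      next
        case b: 2
        have s: "s = 2 * k - 1" "odd s" using b by (auto, presburger)
        have "x j = (lay 0, p (Suc r) 0)" using x_wrap[of r] 2 i b
          by (simp flip: b)
        moreover have "layer_dist (lay s) (lay 0) = 1"
          using b s k by (auto simp: lay_def layer_dist_def elim!: oddE)
        moreover have "1 \<le> r" using r1 b 2 by simp
        ultimately show ?thesis
          using Hj petersen_dist_pos[OF p_wrap(2)[OF _ r10]] x_at[OF i(2), of r] i(1) n s(1) by simp
      next
        case 3
        \<comment> \<open>Positions \<open>2 * k\<close> and 0 are both even, so the two steps cost
          \<open>2 * k + 2\<close> and any positive distance suffices.\<close>
        have "E (Suc i) = E i + 1" using E_step[OF i(2), of r] i 3 by simp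
        moreover have "E (Suc (Suc i)) = E (Suc i) + 1"
          using E_wrap[of r] i 3 by simp
        ultimately show ?thesis using Hj d 2 n by simp
      qed
    next
      case 3
      have "E i + 1 \<le> E j" using E_two[of i] E_mono[of "i + 2" j] 3 by linarith
      moreover have "k * (i + 3) \<le> k * j" using 3 by (rule mult_le_mono2)
      ultimately show ?thesis using d k n unfolding H_def by (simp add: algebra_simps)
    qed
  qed

  \<comment> \<open>Pairs of times across the skip\<close>
  have E_near: "E (n - 1) = k" "E (n - 2) = k" "E (n + 1) = k + 2" "E (n + 2) = k + 2"
    using E_at[of "2 * k" 0] E_at[of "2 * k - 1" 0] E_at[of 1 1] E_at[of 2 1] n k by simp_all
  have x_near: "x (n - 1) = (0, pcol 4 0)" "x (n + 1) = (2 * k, pcol 1 1)"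
    "x (n + 2) = (k - 1, if k = 1 then pcol 4 1 else pcol 2 1)"
    using x_at[of "2 * k" 0] x_at[of 1 1] x_at[of 2 1] n k
    by (auto simp: lay_def p_def round0_def)
  have x_near': "x (n - 2) = (k + 1, pcol 1 0) \<or> x (n - 2) = (k + 1, pcol 3 0)"
  proof -
    have "odd (2 * k - 1)" "(2 * k - 1) div 2 = k - 1" using k by (simp, linarith)
    moreover from this have "(2 * k - 1) mod 4 = 1 \<or> (2 * k - 1) mod 4 = 3" using odd_mod4 by blast
    moreover have "2 * k - 1 \<noteq> 2 * k" using k by simp
    ultimately show ?thesis using x_at[of "2 * k - 1" 0] n k
      by (auto simp: lay_def p_def round0_def)
  qed
  have crossing: "H i + 2 * k + n + 2 \<le> H j + ?d i j"
    if ij: "i < n" "n < j" and d: "1 \<le> ?d i j" for i j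
  proof -
    \<comment> \<open>In the first two cases the times are at least four apart and \<open>E\<close>
      gains 3, so \<open>H\<close> grows by \<open>4 * k + 3 = 2 * k + n + 2\<close> whatever the
      distance. Only the four pairs closest to the skip depend on the columns.\<close>
    consider "j \<ge> n + 3" | "i + 3 \<le> n" | "i + 1 = n \<or> i + 2 = n" "j = n + 1 \<or> j = n + 2"
      using ij by linarith
    then show ?thesis
    proof cases
      case 1
      have "E i \<le> k" using E_mono[of i "n - 1"] E_near ij by simp
      moreover have "k + 3 \<le> E j" using E_two[of "n + 1"] E_near E_mono[OF 1] by (simp add: eval_nat_numeral)
      moreover have "k * (i + 4) \<le> k * j" using ij 1 by (intro mult_le_mono2) simp
      ultimately show ?thesis using n unfolding H_def by (simp add: algebra_simps)
    next
      case 2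
      have "i + 2 \<le> n - 1" using 2 by linarith
      then have "E i + 1 \<le> k" using E_two[of i] E_mono[of "i + 2" "n - 1"] E_near(1) by linarith
      moreover have "k + 2 \<le> E j" using E_mono[of "n + 1" j] E_near ij by simp
      moreover have "k * (i + 4) \<le> k * j" using ij 2 by (intro mult_le_mono2) simp
      ultimately show ?thesis using n unfolding H_def by (simp add: algebra_simps)
    next
      case 3
      have i: "i = n - 1 \<or> i = n - 2" using 3 by auto
      have H_near: "H (n - 1) = k * (n - 1) + k" "H (n - 2) + k = k * (n - 1) + k"
        "H (n + 1) = k * (n - 1) + 3 * k + 2" "H (n + 2) = k * (n - 1) + 4 * k + 2"
        unfolding H_def E_near using n k by (simp_all add: algebra_simps)
      show ?thesis
        using i 3(2) d H_near x_near x_near' pcol_skip petersen_dist_pos[OF pcol_skip(5)] n k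
        by (elim disjE) (auto simp: layer_dist_def split: if_splits)
    qed
  qed
  \<comment> \<open>Makes the subtraction in \<open>g\<close> exact.\<close>
  have H2: "2 * k \<le> H t" if "t > n" for t
  proof -
    have "2 * k \<le> k * t" using that n k by simp
    then show ?thesis unfolding H_def by linarith
  qed
  show thesis
  proof (rule radio_labeling_product_of_sequence[of n "{..10 * n} - {n}" x g])
    show "1 \<le> n" using n by simp
  next
    fix l :: nat and e assume l: "l < n" and e: "e \<in> pverts petersen_graph"
    have col: "\<exists>r<10. e = pcol c r" if "c < 5" for c
      using pcol_image[OF that] e by auto
    show "\<exists>t\<in>{..10 * n} - {n}. x t = (l, e)"
    proof (cases "l = k")
      case True
      obtain r where r: "r < 10" "e = pcol 0 r" using col[of 0] by auto
      \<comment> \<open>The entry missed at the skipped time \<open>n\<close> is visited at time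
        \<open>10 * n\<close>.\<close>
      define r' where "r' = (if r = 1 then 10 else r)"
      have "x (n * r' + 0) = (l, e)" using r True k
        by (subst x_at) (auto simp: lay_def p_def round0_def r'_def)
      moreover have "n * r' + 0 \<in> {..10 * n} - {n}" using r n0 by (auto simp: r'_def)
      ultimately show ?thesis by blast
    next
      case False
      define s where "s = (if l < k then 2 * (k - l) else 2 * (2 * k - l) + 1)"
      have s: "s \<le> 2 * k" "lay s = l" "s \<noteq> 0" using l False n
        by (auto simp: s_def lay_def)
      have "s mod 4 < 5" by presburger
      then have "(if s = 2 * k then 4 else s mod 4) < 5" by simp
      from col[OF this] obtain r where r: "r < 10" "e = pcol (if s = 2 * k then 4 else s mod 4) r"
        by blast
      have "x (n * r + s) = (l, e)" using s r by (simp add: x_at p_def round0)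
      moreover have "n * r + s \<le> 10 * n"
      proof -
        have "n * r + s \<le> n * r + n" using s n by simp
        also have "\<dots> = n * Suc r" by simp
        also have "\<dots> \<le> n * 10" using r by (intro mult_le_mono2) simp
        finally show ?thesis by simp
      qed
      moreover have "n * r + s \<noteq> n" using s n by (cases r) auto
      ultimately show ?thesis by blast
    qed
  next
    fix i j :: nat
    assume ij: "i \<in> {..10 * n} - {n}" "j \<in> {..10 * n} - {n}" "i < j" and d: "1 \<le> ?d i j"
    consider "i > n" | "j < n" | "i < n" "n < j" using ij by force
    then show "g i + n + 2 \<le> g j + ?d i j"
    proof cases
      case 1
      then show ?thesis using same_side[of i j] ij d H2[of i] H2[of j] by (simp add: g_def)
    next
      case 2
      then show ?thesis using same_side[of i j] ij d by (simp add: g_def)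
    next
      case 3
      then show ?thesis using crossing[of i j] d H2[of j] by (simp add: g_def)
    qed
  next
    fix t assume t: "t \<in> {..10 * n} - {n}"
    have H_mono: "H i \<le> H j" if "i \<le> j" for i j
      using E_mono[OF that] that by (simp add: H_def add_mono)
    show "g t \<le> 20 * k * k + 18 * k + 10"
    proof (cases "t > n")
      case True
      \<comment> \<open>The largest label is the one at the added time \<open>10 * n\<close>, namely
        \<open>H (10 * n) - 2 * k\<close>.\<close>
      have "H t \<le> H (n * 10 + 0)" using t by (intro H_mono) simp
      also have "\<dots> = 20 * k * k + 20 * k + 10"
        unfolding H_def by (subst E_at) (simp_all add: n algebra_simps)
      finally show ?thesis using True by (simp add: g_def)
    next
      case False
      then have "H t \<le> H (n * 1 + 0)" by (intro H_mono) simp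
      also have "\<dots> = 2 * k * k + 2 * k + 1"
        unfolding H_def by (subst E_at) (simp_all add: n algebra_simps)
      finally show ?thesis using False by (simp add: g_def)
    qed
  qed (use that in auto)
qed

theorem theorem3:
  fixes n :: nat
  assumes "n \<ge> 3"
  shows "int (radio_number (path_graph n \<box> petersen_graph)) =
           (if even n then 5 * (int n)\<^sup>2 - int n + 1 else 5 * (int n)\<^sup>2 - int n + 6)"
proof -
  let ?G = "path_graph n \<box> petersen_graph"
  obtain \<phi> N where \<phi>: "radio_labeling ?G \<phi>" "labeling_span ?G \<phi> \<le> N"
    and N: "int N = (if even n then 5 * (int n)\<^sup>2 - int n + 1 else 5 * (int n)\<^sup>2 - int n + 6)"
  proof (cases "even n")
    case True
    then obtain m where m: "n = 2 * m" by blast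
    with assms have m2: "m \<ge> 2" by simp
    obtain \<phi> where \<phi>: "radio_labeling ?G \<phi>" "labeling_span ?G \<phi> \<le> 20 * m * m - 2 * m + 1"
      using even_labeling[OF m m2] .
    have "2 * m \<le> 20 * m * m" using m2 by simp
    then have "int (20 * m * m - 2 * m + 1) = 5 * (int n)\<^sup>2 - int n + 1"
      by (simp add: m of_nat_diff power2_eq_square)
    then show ?thesis using that[OF \<phi>] True by simp
  next
    case False
    then obtain k where k: "n = 2 * k + 1" by (elim oddE)
    with assms have k1: "k \<ge> 1" by simp
    obtain \<phi> where \<phi>: "radio_labeling ?G \<phi>" "labeling_span ?G \<phi> \<le> 20 * k * k + 18 * k + 10"
      using odd_labeling[OF k k1] .
    have "int (20 * k * k + 18 * k + 10) = 5 * (int n)\<^sup>2 - int n + 6"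
      by (simp add: k power2_eq_square algebra_simps)
    then show ?thesis using that[OF \<phi>] False by simp
  qed
  have "radio_number ?G = N"
    using radio_labeling_span_ge[OF _ assms] unfolding N[symmetric] of_nat_le_iff
    by (intro radio_number_eqI[OF \<phi>])
  then show ?thesis using N by simp
qed

end
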